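(* Let $\mathcal{M}$ be a small category, $\mathcal{E}$ a topos, $F:\mathcal{M}\to\mathcal{E}$ a functor and $S$ an object of $\mathcal{M}$. Let $(K/D)$ be a dichotomy with quasipolarity $p:S\to S$ for $F$, and let $g:S\to S$ be a counterpoint symmetry for some consonance $\xi:\mathbf{1}\to K$. If $F(g)K$, the image of $K$ under $F(g)$, is not a subobject of $D$ (that is, $F(g)K\not\leq D$ as subobjects of $F(S)$), then $F(g)K\cap K\neq 0$.
   Context: Here $\mathbf{0}$ and $\mathbf{1}$ denote the initial and terminal objects of $\mathcal{E}$; for a subobject $X$, "$X\neq 0$" means that $X$ is not the least (initial) subobject; $\cap$ (also written $\wedge$) is the meet of subobjects of $F(S)$. Quasipolarity: a morphism $p:S\to S$ of $\mathcal{M}$ is a quasipolarity for $F$ if (i) $p\circ p=\mathrm{id}_S$, and (ii) the unique morphism $\mathbf{0}\to F(S)$ is the equalizer in $\mathcal{E}$ of the pair $F(p),\mathrm{id}_{F(S)}:F(S)\to F(S)$. Dichotomy: a dichotomy $(K/D)=(\kappa/\delta)$ relative to a quasipolarity $p:S\to S$ is a pair of monomorphisms $\kappa:K\rightarrowtail F(S)$ and $\delta:D\rightarrowtail F(S)$ in $\mathcal{E}$ such that (i) the canonical morphism $K\amalg D\to F(S)$ is an isomorphism, and (ii) $F(p)\circ\kappa$ and $\delta$ represent the same subobject of $F(S)$. Consonance: for a dichotomy $(\kappa/\delta)$, a consonance is a morphism $\xi:\mathbf{1}\to K$ of $\mathcal{E}$. Counterpoint symmetry: given a dichotomy $(\kappa/\delta)$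 with quasipolarity $p:S\to S$ and a consonance $\xi:\mathbf{1}\to K$, a counterpoint symmetry for $\xi$ is an isomorphism $g:S\to S$ of $\mathcal{M}$ such that (i) $\kappa\circ\xi$ factors through $F(g)\circ\delta$; (ii) $g\circ p=p\circ g$; (iii) if an isomorphism $g':S\to S$ of $\mathcal{M}$ satisfies (i) and (ii) (with $g'$ in place of $g$), then there is a monomorphism in $\mathcal{E}$ from the meet $(F(g')\circ\kappa)\wedge\kappa$ to the meet $(F(g)\circ\kappa)\wedge\kappa$. The subobject $F(g)K$ is the one represented by the monomorphism $F(g)\circ\kappa$. *)

theory Defs
  imports Main
begin

section \<open>Categories and functors\<close>

record ('o, 'a) category =
  Obj :: "'o set"
  Arr :: "'a set"
  Dom :: "'a \<Rightarrow> 'o"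
  Cod :: "'a \<Rightarrow> 'o"
  Id :: "'o \<Rightarrow> 'a"
  Comp :: "'a \<Rightarrow> 'a \<Rightarrow> 'a"  (infixl "\<cdot>\<index>" 70)

text \<open>
  Composition is written in applicative order, and its value on arrows that are not
  composable is unspecified. Objects and arrows form sets over arbitrary types, so
  smallness is no further condition.
\<close>

definition Hom :: "('o, 'a, 'm) category_scheme \<Rightarrow> 'o \<Rightarrow> 'o \<Rightarrow> 'a set" where
  "Hom C A B = {f \<in> Arr C. Dom C f = A \<and> Cod C f = B}"

locale category =
  fixes C :: "('o, 'a, 'm) category_scheme" (structure)
  assumes Dom_Obj: "f \<in> Arr C \<Longrightarrow> Dom C f \<in> Obj C"
    and Cod_Obj: "f \<in> Arr C \<Longrightarrow> Cod C f \<in> Obj C"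
    and Id_Hom: "A \<in> Obj C \<Longrightarrow> Id C A \<in> Hom C A A"
    and Comp_Hom: "\<lbrakk>f \<in> Hom C A B; g \<in> Hom C B D\<rbrakk> \<Longrightarrow> g \<cdot> f \<in> Hom C A D"
    and Id_left: "f \<in> Hom C A B \<Longrightarrow> Id C B \<cdot> f = f"
    and Id_right: "f \<in> Hom C A B \<Longrightarrow> f \<cdot> Id C A = f"
    and Comp_assoc: "\<lbrakk>f \<in> Hom C A B; g \<in> Hom C B D; h \<in> Hom C D G\<rbrakk>
      \<Longrightarrow> (h \<cdot> g) \<cdot> f = h \<cdot> (g \<cdot> f)"

record ('o1, 'a1, 'o2, 'a2) functor_data =
  ob :: "'o1 \<Rightarrow> 'o2"
  ar :: "'a1 \<Rightarrow> 'a2"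

definition is_functor ::
  "('o1, 'a1) category \<Rightarrow> ('o2, 'a2) category \<Rightarrow> ('o1, 'a1, 'o2, 'a2) functor_data \<Rightarrow> bool" where
  "is_functor M E F \<longleftrightarrow>
     category M \<and> category E \<and>
     (\<forall>A\<in>Obj M. ob F A \<in> Obj E) \<and>
     (\<forall>A B. \<forall>f\<in>Hom M A B. ar F f \<in> Hom E (ob F A) (ob F B)) \<and>
     (\<forall>A\<in>Obj M. ar F (Id M A) = Id E (ob F A)) \<and>
     (\<forall>A B D. \<forall>f\<in>Hom M A B. \<forall>g\<in>Hom M B D. ar F (g \<cdot>\<^bsub>M\<^esub> f) = ar F g \<cdot>\<^bsub>E\<^esub> ar F f)"


section \<open>Universal constructions\<close>

definition is_mono :: "('o, 'a) category \<Rightarrow> 'a \<Rightarrow> bool" where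
  "is_mono C m \<longleftrightarrow> m \<in> Arr C \<and>
     (\<forall>X. \<forall>f\<in>Hom C X (Dom C m). \<forall>g\<in>Hom C X (Dom C m). m \<cdot>\<^bsub>C\<^esub> f = m \<cdot>\<^bsub>C\<^esub> g \<longrightarrow> f = g)"

definition is_iso :: "('o, 'a) category \<Rightarrow> 'a \<Rightarrow> bool" where
  "is_iso C f \<longleftrightarrow> f \<in> Arr C \<and>
     (\<exists>g\<in>Hom C (Cod C f) (Dom C f).
        g \<cdot>\<^bsub>C\<^esub> f = Id C (Dom C f) \<and> f \<cdot>\<^bsub>C\<^esub> g = Id C (Cod C f))"

definition is_initial :: "('o, 'a) category \<Rightarrow> 'o \<Rightarrow> bool" where
  "is_initial C Z \<longleftrightarrow> Z \<in> Obj C \<and> (\<forall>X\<in>Obj C. \<exists>!f. f \<in> Hom C Z X)"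

definition is_terminal :: "('o, 'a) category \<Rightarrow> 'o \<Rightarrow> bool" where
  "is_terminal C T \<longleftrightarrow> T \<in> Obj C \<and> (\<forall>X\<in>Obj C. \<exists>!f. f \<in> Hom C X T)"

definition is_product :: "('o, 'a) category \<Rightarrow> 'o \<Rightarrow> 'o \<Rightarrow> 'o \<Rightarrow> 'a \<Rightarrow> 'a \<Rightarrow> bool" where
  "is_product C A B P p q \<longleftrightarrow> p \<in> Hom C P A \<and> q \<in> Hom C P B \<and>
     (\<forall>X. \<forall>f\<in>Hom C X A. \<forall>g\<in>Hom C X B.
        \<exists>!h. h \<in> Hom C X P \<and> p \<cdot>\<^bsub>C\<^esub> h = f \<and> q \<cdot>\<^bsub>C\<^esub> h = g)"

definition is_coproduct :: "('o, 'a) category \<Rightarrow> 'o \<Rightarrow> 'o \<Rightarrow> 'o \<Rightarrow> 'a \<Rightarrow> 'a \<Rightarrow> bool" where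
  "is_coproduct C A B Q i j \<longleftrightarrow> i \<in> Hom C A Q \<and> j \<in> Hom C B Q \<and>
     (\<forall>X. \<forall>f\<in>Hom C A X. \<forall>g\<in>Hom C B X.
        \<exists>!h. h \<in> Hom C Q X \<and> h \<cdot>\<^bsub>C\<^esub> i = f \<and> h \<cdot>\<^bsub>C\<^esub> j = g)"

definition is_equalizer :: "('o, 'a) category \<Rightarrow> 'a \<Rightarrow> 'a \<Rightarrow> 'a \<Rightarrow> bool" where
  "is_equalizer C f g e \<longleftrightarrow>
     f \<in> Arr C \<and> g \<in> Hom C (Dom C f) (Cod C f) \<and> e \<in> Hom C (Dom C e) (Dom C f) \<and>
     f \<cdot>\<^bsub>C\<^esub> e = g \<cdot>\<^bsub>C\<^esub> e \<and>
     (\<forall>X. \<forall>h\<in>Hom C X (Dom C f). f \<cdot>\<^bsub>C\<^esub> h = g \<cdot>\<^bsub>C\<^esub> h \<longrightarrow>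
        (\<exists>!u. u \<in> Hom C X (Dom C e) \<and> e \<cdot>\<^bsub>C\<^esub> u = h))"

definition is_pullback :: "('o, 'a) category \<Rightarrow> 'a \<Rightarrow> 'a \<Rightarrow> 'a \<Rightarrow> 'a \<Rightarrow> bool" where
  "is_pullback C f g p q \<longleftrightarrow>
     f \<in> Arr C \<and> g \<in> Hom C (Dom C g) (Cod C f) \<and>
     p \<in> Hom C (Dom C p) (Dom C f) \<and> q \<in> Hom C (Dom C p) (Dom C g) \<and>
     f \<cdot>\<^bsub>C\<^esub> p = g \<cdot>\<^bsub>C\<^esub> q \<and>
     (\<forall>X. \<forall>u\<in>Hom C X (Dom C f). \<forall>v\<in>Hom C X (Dom C g). f \<cdot>\<^bsub>C\<^esub> u = g \<cdot>\<^bsub>C\<^esub> v \<longrightarrow>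
        (\<exists>!h. h \<in> Hom C X (Dom C p) \<and> p \<cdot>\<^bsub>C\<^esub> h = u \<and> q \<cdot>\<^bsub>C\<^esub> h = v))"

text \<open>
  \<open>W\<close> is the exponential \<open>B\<^sup>A\<close>, with product \<open>P = W \<times> A\<close> and evaluation \<open>ev : P \<rightarrow> B\<close>.
  The arrow \<open>k\<close> below is \<open>h \<times> id\<^sub>A\<close>.
\<close>

definition is_exponential ::
  "('o, 'a) category \<Rightarrow> 'o \<Rightarrow> 'o \<Rightarrow> 'o \<Rightarrow> 'o \<Rightarrow> 'a \<Rightarrow> 'a \<Rightarrow> 'a \<Rightarrow> bool" where
  "is_exponential C A B W P p q ev \<longleftrightarrow>
     is_product C W A P p q \<and> ev \<in> Hom C P B \<and>
     (\<forall>X Q r s f. is_product C X A Q r s \<and> f \<in> Hom C Q B \<longrightarrow>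
        (\<exists>!h. h \<in> Hom C X W \<and>
           (\<exists>k\<in>Hom C Q P. p \<cdot>\<^bsub>C\<^esub> k = h \<cdot>\<^bsub>C\<^esub> r \<and> q \<cdot>\<^bsub>C\<^esub> k = s \<and> ev \<cdot>\<^bsub>C\<^esub> k = f)))"

definition is_subobject_classifier :: "('o, 'a) category \<Rightarrow> 'a \<Rightarrow> bool" where
  "is_subobject_classifier C t \<longleftrightarrow>
     t \<in> Arr C \<and> is_terminal C (Dom C t) \<and>
     (\<forall>m. is_mono C m \<longrightarrow>
        (\<exists>!\<chi>. \<chi> \<in> Hom C (Cod C m) (Cod C t) \<and>
           (\<exists>u\<in>Hom C (Dom C m) (Dom C t). is_pullback C \<chi> t m u)))"

text \<open>
  Elementary toposes. Finite limits are given by a terminal object, binary products and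
  equalizers; finite colimits then exist and are not postulated.
\<close>

definition topos :: "('o, 'a) category \<Rightarrow> bool" where
  "topos C \<longleftrightarrow>
     category C \<and>
     (\<exists>T. is_terminal C T) \<and>
     (\<forall>A\<in>Obj C. \<forall>B\<in>Obj C. \<exists>P p q. is_product C A B P p q) \<and>
     (\<forall>A B. \<forall>f\<in>Hom C A B. \<forall>g\<in>Hom C A B. \<exists>e. is_equalizer C f g e) \<and>
     (\<forall>A\<in>Obj C. \<forall>B\<in>Obj C. \<exists>W P p q ev. is_exponential C A B W P p q ev) \<and>
     (\<exists>t. is_subobject_classifier C t)"


section \<open>Subobjects\<close>

text \<open>
  A subobject of \<open>A\<close> is given by a representing monomorphism. The meet is determined only up
  to equivalence, so it appears as a relation between representatives.
\<close>

definition factors_through :: "('o, 'a) category \<Rightarrow> 'a \<Rightarrow> 'a \<Rightarrow> bool" where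
  "factors_through C f m \<longleftrightarrow> (\<exists>h\<in>Hom C (Dom C f) (Dom C m). m \<cdot>\<^bsub>C\<^esub> h = f)"

definition represents_sub :: "('o, 'a) category \<Rightarrow> 'o \<Rightarrow> 'a \<Rightarrow> bool" where
  "represents_sub C A m \<longleftrightarrow> is_mono C m \<and> Cod C m = A"

definition sub_le :: "('o, 'a) category \<Rightarrow> 'o \<Rightarrow> 'a \<Rightarrow> 'a \<Rightarrow> bool" where
  "sub_le C A m n \<longleftrightarrow> represents_sub C A m \<and> represents_sub C A n \<and> factors_through C m n"

definition same_sub :: "('o, 'a) category \<Rightarrow> 'o \<Rightarrow> 'a \<Rightarrow> 'a \<Rightarrow> bool" where
  "same_sub C A m n \<longleftrightarrow> sub_le C A m n \<and> sub_le C A n m"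

definition is_meet :: "('o, 'a) category \<Rightarrow> 'o \<Rightarrow> 'a \<Rightarrow> 'a \<Rightarrow> 'a \<Rightarrow> bool" where
  "is_meet C A m n w \<longleftrightarrow>
     sub_le C A w m \<and> sub_le C A w n \<and>
     (\<forall>x. sub_le C A x m \<and> sub_le C A x n \<longrightarrow> sub_le C A x w)"

text \<open>
  The zero subobject is the least one; in a topos it is represented by \<open>0 \<rightarrow> A\<close>.
\<close>

definition is_zero_sub :: "('o, 'a) category \<Rightarrow> 'o \<Rightarrow> 'a \<Rightarrow> bool" where
  "is_zero_sub C A m \<longleftrightarrow>
     represents_sub C A m \<and> (\<forall>n. represents_sub C A n \<longrightarrow> sub_le C A m n)"


section \<open>Counterpoint\<close>

definition quasipolarity ::
  "('o1, 'a1) category \<Rightarrow> ('o2, 'a2) category \<Rightarrow> ('o1, 'a1, 'o2, 'a2) functor_data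
     \<Rightarrow> 'o1 \<Rightarrow> 'a1 \<Rightarrow> bool" where
  "quasipolarity M E F S p \<longleftrightarrow>
     p \<in> Hom M S S \<and> p \<cdot>\<^bsub>M\<^esub> p = Id M S \<and>
     (\<exists>Z i. is_initial E Z \<and> i \<in> Hom E Z (ob F S) \<and>
            is_equalizer E (ar F p) (Id E (ob F S)) i)"

text \<open>
  \<open>K\<close> and \<open>D\<close> are the domains of \<open>\<kappa>\<close> and \<open>\<delta>\<close>; the arrow \<open>c\<close> below is the canonical
  one from the coproduct \<open>Q\<close> of \<open>K\<close> and \<open>D\<close>.
\<close>

definition dichotomy ::
  "('o1, 'a1) category \<Rightarrow> ('o2, 'a2) category \<Rightarrow> ('o1, 'a1, 'o2, 'a2) functor_data
     \<Rightarrow> 'o1 \<Rightarrow> 'a1 \<Rightarrow> 'a2 \<Rightarrow> 'a2 \<Rightarrow> bool" where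
  "dichotomy M E F S p \<kappa> \<delta> \<longleftrightarrow>
     quasipolarity M E F S p \<and>
     represents_sub E (ob F S) \<kappa> \<and> represents_sub E (ob F S) \<delta> \<and>
     (\<exists>Q i j c. is_coproduct E (Dom E \<kappa>) (Dom E \<delta>) Q i j \<and> c \<in> Hom E Q (ob F S) \<and>
        c \<cdot>\<^bsub>E\<^esub> i = \<kappa> \<and> c \<cdot>\<^bsub>E\<^esub> j = \<delta> \<and> is_iso E c) \<and>
     same_sub E (ob F S) (ar F p \<cdot>\<^bsub>E\<^esub> \<kappa>) \<delta>"

definition consonance :: "('o2, 'a2) category \<Rightarrow> 'a2 \<Rightarrow> 'a2 \<Rightarrow> bool" where
  "consonance E \<kappa> \<xi> \<longleftrightarrow> (\<exists>T. is_terminal E T \<and> \<xi> \<in> Hom E T (Dom E \<kappa>))"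

text \<open>Conditions (i) and (ii) on a counterpoint symmetry, which its condition (iii) refers to.\<close>

definition symmetry_candidate ::
  "('o1, 'a1) category \<Rightarrow> ('o2, 'a2) category \<Rightarrow> ('o1, 'a1, 'o2, 'a2) functor_data
     \<Rightarrow> 'o1 \<Rightarrow> 'a1 \<Rightarrow> 'a2 \<Rightarrow> 'a2 \<Rightarrow> 'a2 \<Rightarrow> 'a1 \<Rightarrow> bool" where
  "symmetry_candidate M E F S p \<kappa> \<delta> \<xi> g \<longleftrightarrow>
     g \<in> Hom M S S \<and> is_iso M g \<and>
     factors_through E (\<kappa> \<cdot>\<^bsub>E\<^esub> \<xi>) (ar F g \<cdot>\<^bsub>E\<^esub> \<delta>) \<and>
     g \<cdot>\<^bsub>M\<^esub> p = p \<cdot>\<^bsub>M\<^esub> g"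

definition counterpoint_symmetry ::
  "('o1, 'a1) category \<Rightarrow> ('o2, 'a2) category \<Rightarrow> ('o1, 'a1, 'o2, 'a2) functor_data
     \<Rightarrow> 'o1 \<Rightarrow> 'a1 \<Rightarrow> 'a2 \<Rightarrow> 'a2 \<Rightarrow> 'a2 \<Rightarrow> 'a1 \<Rightarrow> bool" where
  "counterpoint_symmetry M E F S p \<kappa> \<delta> \<xi> g \<longleftrightarrow>
     symmetry_candidate M E F S p \<kappa> \<delta> \<xi> g \<and>
     (\<forall>g'. symmetry_candidate M E F S p \<kappa> \<delta> \<xi> g' \<longrightarrow>
        (\<forall>w' w. is_meet E (ob F S) (ar F g' \<cdot>\<^bsub>E\<^esub> \<kappa>) \<kappa> w' \<and>
                is_meet E (ob F S) (ar F g \<cdot>\<^bsub>E\<^esub> \<kappa>) \<kappa> w \<longrightarrow>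
           (\<exists>m\<in>Hom E (Dom E w') (Dom E w). is_mono E m)))"

end

theory Submission imports Defs begin

text \<open>
  Write \<open>A\<close> for \<open>F(S)\<close> and \<open>m\<close> for \<open>F(g) \<circ> \<kappa>\<close>. Because \<open>A\<close> is the coproduct of \<open>K\<close> and
  \<open>D\<close>, distributivity of the subobject lattice gives
  \<open>m = (m \<and> \<kappa>) \<or> (m \<and> \<delta>)\<close>; if \<open>m \<and> \<kappa>\<close> is zero, then \<open>m = m \<and> \<delta> \<le> \<delta>\<close>, against the
  hypothesis.

  Distributivity is obtained here without constructing joins or proving that coproducts are
  stable under pullback. To see that \<open>m \<le> n\<close> for \<open>n = m \<and> \<delta>\<close>, compare the
  characteristic maps \<open>A \<rightarrow> \<Omega>\<close> of the two subobjects. The coprojections of \<open>A\<close> are jointly epic,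
  so it suffices to compare these maps after composing with \<open>\<kappa>\<close> and with \<open>\<delta>\<close>. A map into
  \<open>\<Omega>\<close> is in turn determined by the generalized elements that it sends to true
  (\<open>truth_maps_eqI\<close>), so the comparison only asks which generalized elements of \<open>K\<close> and of \<open>D\<close>
  lie in \<open>m\<close> and in \<open>n\<close>. This is \<open>sub_le_on_cover\<close>. On \<open>D\<close> the subobjects \<open>m\<close> and \<open>m \<and> \<delta>\<close>
  have the same elements, and on \<open>K\<close> the elements of \<open>m\<close> lie in \<open>m \<and> \<kappa>\<close>, hence in every
  subobject.
\<close>

section \<open>Monomorphisms and factorization\<close>

lemma HomD:
  assumes "f \<in> Hom C A B"
  shows "f \<in> Arr C" "Dom C f = A" "Cod C f = B"
  using assms by (auto simp: Hom_def)

lemma Arr_Hom: "f \<in> Arr C \<Longrightarrow> f \<in> Hom C (Dom C f) (Cod C f)"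
  by (simp add: Hom_def)

lemma mono_cancel:
  assumes "is_mono C m" "f \<in> Hom C X (Dom C m)" "g \<in> Hom C X (Dom C m)"
    and "m \<cdot>\<^bsub>C\<^esub> f = m \<cdot>\<^bsub>C\<^esub> g"
  shows "f = g"
  using assms by (auto simp: is_mono_def)

lemma mono_comp:
  assumes C: "category C" and m: "is_mono C m" and e: "is_mono C e" "Cod C e = Dom C m"
  shows "is_mono C (m \<cdot>\<^bsub>C\<^esub> e)"
proof -
  interpret category C by fact
  have mH: "m \<in> Hom C (Dom C m) (Cod C m)" and eH: "e \<in> Hom C (Dom C e) (Dom C m)"
    using m e by (auto simp: is_mono_def Hom_def)
  have H: "m \<cdot>\<^bsub>C\<^esub> e \<in> Hom C (Dom C e) (Cod C m)"
    using Comp_Hom[OF eH mH] .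
  have "f = g" if "f \<in> Hom C X (Dom C e)" "g \<in> Hom C X (Dom C e)"
    "(m \<cdot>\<^bsub>C\<^esub> e) \<cdot>\<^bsub>C\<^esub> f = (m \<cdot>\<^bsub>C\<^esub> e) \<cdot>\<^bsub>C\<^esub> g" for X f g
  proof -
    have "m \<cdot>\<^bsub>C\<^esub> (e \<cdot>\<^bsub>C\<^esub> f) = m \<cdot>\<^bsub>C\<^esub> (e \<cdot>\<^bsub>C\<^esub> g)"
      using that Comp_assoc[OF _ eH mH] by metis
    then have "e \<cdot>\<^bsub>C\<^esub> f = e \<cdot>\<^bsub>C\<^esub> g"
      using mono_cancel[OF m Comp_Hom[OF that(1) eH] Comp_Hom[OF that(2) eH]] by simp
    then show ?thesis
      using mono_cancel[OF e(1)] that by blast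
  qed
  then show ?thesis
    using HomD[OF H] by (auto simp: is_mono_def)
qed

lemma factors_through_compI:
  "\<lbrakk>h \<in> Hom C (Dom C f) (Dom C m); f = m \<cdot>\<^bsub>C\<^esub> h\<rbrakk> \<Longrightarrow> factors_through C f m"
  by (auto simp: factors_through_def)

lemma factors_through_trans:
  assumes C: "category C" and "factors_through C f n" "factors_through C n m" "m \<in> Arr C"
  shows "factors_through C f m"
proof -
  interpret category C by fact
  obtain h k where h: "h \<in> Hom C (Dom C f) (Dom C n)" "n \<cdot>\<^bsub>C\<^esub> h = f"
    and k: "k \<in> Hom C (Dom C n) (Dom C m)" "m \<cdot>\<^bsub>C\<^esub> k = n"
    using assms by (auto simp: factors_through_def)
  have "m \<cdot>\<^bsub>C\<^esub> (k \<cdot>\<^bsub>C\<^esub> h) = f"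
    using Comp_assoc[OF h(1) k(1) Arr_Hom[OF \<open>m \<in> Arr C\<close>]] h(2) k(2) by simp
  then show ?thesis
    using Comp_Hom[OF h(1) k(1)] by (auto intro: factors_through_compI)
qed

lemma equalizer_mono:
  assumes C: "category C" and e: "is_equalizer C f g e"
  shows "is_mono C e"
proof -
  interpret category C by fact
  have eH: "e \<in> Hom C (Dom C e) (Dom C f)" and fH: "f \<in> Hom C (Dom C f) (Cod C f)"
    and gH: "g \<in> Hom C (Dom C f) (Cod C f)" and eq: "f \<cdot>\<^bsub>C\<^esub> e = g \<cdot>\<^bsub>C\<^esub> e"
    using e by (auto simp: is_equalizer_def Hom_def)
  have "a = b" if a: "a \<in> Hom C X (Dom C e)" and b: "b \<in> Hom C X (Dom C e)"
    and ab: "e \<cdot>\<^bsub>C\<^esub> a = e \<cdot>\<^bsub>C\<^esub> b" for X a b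
  proof -
    have "e \<cdot>\<^bsub>C\<^esub> a \<in> Hom C X (Dom C f)" using Comp_Hom[OF a eH] .
    moreover have "f \<cdot>\<^bsub>C\<^esub> (e \<cdot>\<^bsub>C\<^esub> a) = g \<cdot>\<^bsub>C\<^esub> (e \<cdot>\<^bsub>C\<^esub> a)"
      using Comp_assoc[OF a eH fH] Comp_assoc[OF a eH gH] eq by simp
    ultimately have "\<exists>!u. u \<in> Hom C X (Dom C e) \<and> e \<cdot>\<^bsub>C\<^esub> u = e \<cdot>\<^bsub>C\<^esub> a"
      using e by (auto simp: is_equalizer_def)
    then show ?thesis using a b ab by metis
  qed
  then show ?thesis using HomD[OF eH] by (auto simp: is_mono_def)
qed

section \<open>Generalized elements and truth values\<close>

text \<open>
  For \<open>t : \<one> \<rightarrow> \<Omega>\<close> and \<open>f : Y \<rightarrow> X\<close> the arrow \<open>v\<close> can only be \<open>Y \<rightarrow> \<one>\<close>, so this is the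
  forcing relation of the internal language: \<open>Y\<close> forces \<open>\<chi>\<close> at the generalized element \<open>f\<close>.
\<close>

definition sends_to_true :: "('o, 'a) category \<Rightarrow> 'a \<Rightarrow> 'a \<Rightarrow> 'a \<Rightarrow> bool" where
  "sends_to_true C t \<chi> f \<longleftrightarrow> (\<exists>v\<in>Hom C (Dom C f) (Dom C t). \<chi> \<cdot>\<^bsub>C\<^esub> f = t \<cdot>\<^bsub>C\<^esub> v)"

lemma sends_to_true_comp:
  assumes C: "category C" and "f \<in> Hom C Y X" "k \<in> Hom C X A" "\<chi> \<in> Hom C A B"
  shows "sends_to_true C t (\<chi> \<cdot>\<^bsub>C\<^esub> k) f \<longleftrightarrow> sends_to_true C t \<chi> (k \<cdot>\<^bsub>C\<^esub> f)"
proof -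
  interpret category C by fact
  show ?thesis
    using Comp_assoc[OF assms(2-4)] HomD[OF assms(2)] HomD[OF Comp_Hom[OF assms(2,3)]]
    by (simp add: sends_to_true_def)
qed

lemma pullback_sends_to_true_iff:
  assumes C: "category C" and t: "t \<in> Arr C" and \<chi>: "\<chi> \<in> Hom C (Cod C m) (Cod C t)"
    and pb: "is_pullback C \<chi> t m u" and f: "f \<in> Hom C Y (Cod C m)"
  shows "sends_to_true C t \<chi> f \<longleftrightarrow> factors_through C f m"
proof
  interpret category C by fact
  have D: "Dom C \<chi> = Cod C m" "Dom C f = Y" using \<chi> f by (auto simp: Hom_def)
  { assume "sends_to_true C t \<chi> f"
    then obtain v where "v \<in> Hom C Y (Dom C t)" "\<chi> \<cdot>\<^bsub>C\<^esub> f = t \<cdot>\<^bsub>C\<^esub> v"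
      using D by (auto simp: sends_to_true_def)
    then have "\<exists>h. h \<in> Hom C Y (Dom C m) \<and> m \<cdot>\<^bsub>C\<^esub> h = f"
      using pb f D unfolding is_pullback_def by (metis (no_types, lifting))
    then show "factors_through C f m"
      using D by (auto simp: factors_through_def) }
  { assume "factors_through C f m"
    then obtain h where h: "h \<in> Hom C Y (Dom C m)" "m \<cdot>\<^bsub>C\<^esub> h = f"
      using D by (auto simp: factors_through_def)
    have mH: "m \<in> Hom C (Dom C m) (Cod C m)" and uH: "u \<in> Hom C (Dom C m) (Dom C t)"
      and sq: "\<chi> \<cdot>\<^bsub>C\<^esub> m = t \<cdot>\<^bsub>C\<^esub> u"
      using pb D by (auto simp: is_pullback_def)
    have "\<chi> \<cdot>\<^bsub>C\<^esub> f = t \<cdot>\<^bsub>C\<^esub> (u \<cdot>\<^bsub>C\<^esub> h)"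
      using Comp_assoc[OF h(1) mH \<chi>] Comp_assoc[OF h(1) uH Arr_Hom[OF t]] sq h(2) by simp
    then show "sends_to_true C t \<chi> f"
      using Comp_Hom[OF h(1) uH] D by (auto simp: sends_to_true_def) }
qed

text \<open>
  The truth locus of \<open>\<chi>\<close> is the equalizer of \<open>\<chi>\<close> with the map that is constantly true, so
  it exists without any appeal to general pullbacks.
\<close>

lemma truth_locus_exists:
  assumes top: "topos C" and t: "is_subobject_classifier C t"
    and \<chi>: "\<chi> \<in> Hom C X (Cod C t)"
  obtains e where "is_mono C e" "Cod C e = X"
    and "\<And>Y f. f \<in> Hom C Y X \<Longrightarrow> factors_through C f e \<longleftrightarrow> sends_to_true C t \<chi> f"
proof -
  have C: "category C" using top by (simp add: topos_def)
  interpret category C by fact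
  have tA: "t \<in> Arr C" and T: "is_terminal C (Dom C t)"
    using t by (auto simp: is_subobject_classifier_def)
  have tH: "t \<in> Hom C (Dom C t) (Cod C t)" using Arr_Hom[OF tA] .
  have X: "X \<in> Obj C" using \<chi> Dom_Obj by (auto simp: Hom_def)
  obtain v where v: "v \<in> Hom C X (Dom C t)" using T X by (auto simp: is_terminal_def)
  have tv: "t \<cdot>\<^bsub>C\<^esub> v \<in> Hom C X (Cod C t)" using Comp_Hom[OF v tH] .
  obtain e where e: "is_equalizer C \<chi> (t \<cdot>\<^bsub>C\<^esub> v) e"
    using top \<chi> tv unfolding topos_def by blast
  have D: "Dom C \<chi> = X" using \<chi> by (simp add: Hom_def)
  have eH: "e \<in> Hom C (Dom C e) X" and ee: "\<chi> \<cdot>\<^bsub>C\<^esub> e = (t \<cdot>\<^bsub>C\<^esub> v) \<cdot>\<^bsub>C\<^esub> e"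
    using e D by (auto simp: is_equalizer_def)
  have "factors_through C f e \<longleftrightarrow> sends_to_true C t \<chi> f" if f: "f \<in> Hom C Y X" for Y f
  proof
    have Df: "Dom C f = Y" and Y: "Y \<in> Obj C" using f Dom_Obj by (auto simp: Hom_def)
    have vf: "v \<cdot>\<^bsub>C\<^esub> f \<in> Hom C Y (Dom C t)" using Comp_Hom[OF f v] .
    have tvf: "(t \<cdot>\<^bsub>C\<^esub> v) \<cdot>\<^bsub>C\<^esub> f = t \<cdot>\<^bsub>C\<^esub> (v \<cdot>\<^bsub>C\<^esub> f)" using Comp_assoc[OF f v tH] .
    { assume "factors_through C f e"
      then obtain h where h: "h \<in> Hom C Y (Dom C e)" "e \<cdot>\<^bsub>C\<^esub> h = f"
        using Df by (auto simp: factors_through_def)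
      have "\<chi> \<cdot>\<^bsub>C\<^esub> f = t \<cdot>\<^bsub>C\<^esub> (v \<cdot>\<^bsub>C\<^esub> f)"
        using Comp_assoc[OF h(1) eH \<chi>] Comp_assoc[OF h(1) eH tv] ee h(2) tvf by simp
      then show "sends_to_true C t \<chi> f"
        using vf Df by (auto simp: sends_to_true_def) }
    { assume "sends_to_true C t \<chi> f"
      then obtain z where z: "z \<in> Hom C Y (Dom C t)" "\<chi> \<cdot>\<^bsub>C\<^esub> f = t \<cdot>\<^bsub>C\<^esub> z"
        using Df by (auto simp: sends_to_true_def)
      have "z = v \<cdot>\<^bsub>C\<^esub> f" using T Y z(1) vf by (auto simp: is_terminal_def)
      then have "\<chi> \<cdot>\<^bsub>C\<^esub> f = (t \<cdot>\<^bsub>C\<^esub> v) \<cdot>\<^bsub>C\<^esub> f" using z(2) tvf by simp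
      then have "\<exists>u. u \<in> Hom C Y (Dom C e) \<and> e \<cdot>\<^bsub>C\<^esub> u = f"
        using e f D unfolding is_equalizer_def by (metis (no_types, lifting))
      then show "factors_through C f e" using Df by (auto simp: factors_through_def) }
  qed
  then show ?thesis using that equalizer_mono[OF C e] HomD[OF eH] by blast
qed

text \<open>
  A subobject is determined by its elements, and a map into \<open>\<Omega>\<close> is determined by the subobject
  it classifies: the truth locus of \<open>\<phi>\<close> is classified by \<open>\<psi>\<close> as well, and the characteristic map
  of a subobject is unique.
\<close>

lemma truth_maps_eqI:
  assumes top: "topos C" and t: "is_subobject_classifier C t"
    and \<phi>: "\<phi> \<in> Hom C X (Cod C t)" and \<psi>: "\<psi> \<in> Hom C X (Cod C t)"
    and same: "\<And>Y f. f \<in> Hom C Y X \<Longrightarrow> sends_to_true C t \<phi> f \<longleftrightarrow> sends_to_true C t \<psi> f"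
  shows "\<phi> = \<psi>"
proof -
  have C: "category C" using top by (simp add: topos_def)
  interpret category C by fact
  have tA: "t \<in> Arr C" and T: "is_terminal C (Dom C t)"
    using t by (auto simp: is_subobject_classifier_def)
  obtain e where e: "is_mono C e" "Cod C e = X"
    and locus: "\<And>Y f. f \<in> Hom C Y X \<Longrightarrow> factors_through C f e \<longleftrightarrow> sends_to_true C t \<phi> f"
    using truth_locus_exists[OF top t \<phi>] by blast
  have eH: "e \<in> Hom C (Dom C e) X" using e by (auto simp: is_mono_def Hom_def)
  have W: "Dom C e \<in> Obj C" using eH Dom_Obj by (auto simp: Hom_def)
  obtain u where u: "u \<in> Hom C (Dom C e) (Dom C t)" using T W by (auto simp: is_terminal_def)
  have classified: "is_pullback C \<chi> t e u"
    if \<chi>: "\<chi> \<in> Hom C X (Cod C t)"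
      and lc: "\<And>Y f. f \<in> Hom C Y X \<Longrightarrow> factors_through C f e \<longleftrightarrow> sends_to_true C t \<chi> f" for \<chi>
  proof -
    have D: "\<chi> \<in> Arr C" "Dom C \<chi> = X" "Cod C \<chi> = Cod C t" using \<chi> by (auto simp: Hom_def)
    have "e \<cdot>\<^bsub>C\<^esub> Id C (Dom C e) = e" using Id_right[OF eH] .
    then have "factors_through C e e"
      using Id_Hom[OF W] by (auto simp: factors_through_def)
    then obtain z where z: "z \<in> Hom C (Dom C e) (Dom C t)" "\<chi> \<cdot>\<^bsub>C\<^esub> e = t \<cdot>\<^bsub>C\<^esub> z"
      using lc[OF eH] by (auto simp: sends_to_true_def)
    have zu: "z = u" using z(1) u T W by (auto simp: is_terminal_def)
    have "\<exists>!h. h \<in> Hom C Y (Dom C e) \<and> e \<cdot>\<^bsub>C\<^esub> h = a \<and> u \<cdot>\<^bsub>C\<^esub> h = b"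
      if a: "a \<in> Hom C Y X" and b: "b \<in> Hom C Y (Dom C t)"
        and ab: "\<chi> \<cdot>\<^bsub>C\<^esub> a = t \<cdot>\<^bsub>C\<^esub> b" for Y a b
    proof -
      have Y: "Y \<in> Obj C" "Dom C a = Y" using a Dom_Obj by (auto simp: Hom_def)
      have "factors_through C a e"
        using lc[OF a] ab b Y by (auto simp: sends_to_true_def)
      then obtain h where h: "h \<in> Hom C Y (Dom C e)" "e \<cdot>\<^bsub>C\<^esub> h = a"
        using Y by (auto simp: factors_through_def)
      have "u \<cdot>\<^bsub>C\<^esub> h = b"
        using Comp_Hom[OF h(1) u] b T Y by (auto simp: is_terminal_def)
      moreover have "h' = h" if "h' \<in> Hom C Y (Dom C e)" "e \<cdot>\<^bsub>C\<^esub> h' = a" for h'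
        using mono_cancel[OF e(1) that(1) h(1)] that(2) h(2) by simp
      ultimately show ?thesis using h by blast
    qed
    then show ?thesis
      using D tA eH u z(2) zu Arr_Hom[OF tA] by (auto simp: is_pullback_def)
  qed
  have "is_pullback C \<phi> t e u" "is_pullback C \<psi> t e u"
    using classified[OF \<phi> locus] classified[OF \<psi>] locus same by auto
  moreover have "\<exists>!\<chi>. \<chi> \<in> Hom C X (Cod C t) \<and>
      (\<exists>u\<in>Hom C (Dom C e) (Dom C t). is_pullback C \<chi> t e u)"
    using t e unfolding is_subobject_classifier_def by blast
  ultimately show ?thesis using \<phi> \<psi> u by blast
qed

section \<open>Meets and inclusions tested on elements\<close>

text \<open>
  The defining property of a meet tests it against subobjects only. The meet built here,
  the truth locus on the domain of \<open>m\<close> of the restricted characteristic map of \<open>n\<close>, is a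
  pullback and so also contains every generalized element common to \<open>m\<close> and \<open>n\<close>.
\<close>

lemma elementwise_meet_exists:
  assumes top: "topos C" and m: "represents_sub C A m" and n: "represents_sub C A n"
  obtains w where "sub_le C A w m" "sub_le C A w n"
    and "\<And>Y f. \<lbrakk>f \<in> Hom C Y A; factors_through C f m; factors_through C f n\<rbrakk>
      \<Longrightarrow> factors_through C f w"
proof -
  have C: "category C" using top by (simp add: topos_def)
  interpret category C by fact
  obtain t where t: "is_subobject_classifier C t" using top by (auto simp: topos_def)
  have tA: "t \<in> Arr C" using t by (auto simp: is_subobject_classifier_def)
  have m': "is_mono C m" "Cod C m = A" and n': "is_mono C n" "Cod C n = A"
    using m n by (auto simp: represents_sub_def)
  have mH: "m \<in> Hom C (Dom C m) A" using m' by (auto simp: is_mono_def Hom_def)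
  obtain \<chi> u where \<chi>: "\<chi> \<in> Hom C A (Cod C t)" and pb: "is_pullback C \<chi> t n u"
    using t n' unfolding is_subobject_classifier_def by metis
  have in_n: "sends_to_true C t \<chi> f \<longleftrightarrow> factors_through C f n" if "f \<in> Hom C Y A" for Y f
    using pullback_sends_to_true_iff[OF C tA _ pb] \<chi> n' that by simp
  have \<chi>m: "\<chi> \<cdot>\<^bsub>C\<^esub> m \<in> Hom C (Dom C m) (Cod C t)" using Comp_Hom[OF mH \<chi>] .
  obtain e where e: "is_mono C e" "Cod C e = Dom C m"
    and locus: "\<And>Y f. f \<in> Hom C Y (Dom C m) \<Longrightarrow>
      factors_through C f e \<longleftrightarrow> sends_to_true C t (\<chi> \<cdot>\<^bsub>C\<^esub> m) f"
    using truth_locus_exists[OF top t \<chi>m] by blast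
  have eH: "e \<in> Hom C (Dom C e) (Dom C m)" using e by (auto simp: is_mono_def Hom_def)
  have meH: "m \<cdot>\<^bsub>C\<^esub> e \<in> Hom C (Dom C e) A" using Comp_Hom[OF eH mH] .
  have in_e: "factors_through C h e \<longleftrightarrow> factors_through C (m \<cdot>\<^bsub>C\<^esub> h) n"
    if h: "h \<in> Hom C Y (Dom C m)" for Y h
    using locus[OF h] sends_to_true_comp[OF C h mH \<chi>] in_n[OF Comp_Hom[OF h mH]] by simp
  have rep: "represents_sub C A (m \<cdot>\<^bsub>C\<^esub> e)"
    using mono_comp[OF C m'(1) e] HomD[OF meH] by (simp add: represents_sub_def)
  have "factors_through C (m \<cdot>\<^bsub>C\<^esub> e) m"
    using eH HomD[OF meH] by (auto intro: factors_through_compI)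
  then have le_m: "sub_le C A (m \<cdot>\<^bsub>C\<^esub> e) m" using rep m by (simp add: sub_le_def)
  have "e \<cdot>\<^bsub>C\<^esub> Id C (Dom C e) = e" "Dom C e \<in> Obj C"
    using Id_right[OF eH] Dom_Obj HomD[OF eH] by auto
  then have "factors_through C e e" using Id_Hom by (auto simp: factors_through_def)
  then have le_n: "sub_le C A (m \<cdot>\<^bsub>C\<^esub> e) n" using in_e[OF eH] rep n by (simp add: sub_le_def)
  have "factors_through C f (m \<cdot>\<^bsub>C\<^esub> e)"
    if f: "f \<in> Hom C Y A" "factors_through C f m" "factors_through C f n" for Y f
  proof -
    obtain h where h: "h \<in> Hom C Y (Dom C m)" "m \<cdot>\<^bsub>C\<^esub> h = f"
      using f HomD[OF f(1)] by (auto simp: factors_through_def)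
    then obtain k where k: "k \<in> Hom C Y (Dom C e)" "e \<cdot>\<^bsub>C\<^esub> k = h"
      using in_e[OF h(1)] f(3) HomD[OF h(1)] by (auto simp: factors_through_def)
    have "(m \<cdot>\<^bsub>C\<^esub> e) \<cdot>\<^bsub>C\<^esub> k = f" using Comp_assoc[OF k(1) eH mH] k h by simp
    then show ?thesis
      using k HomD[OF f(1)] HomD[OF meH] by (auto simp: factors_through_def)
  qed
  then show ?thesis using that le_m le_n by blast
qed

text \<open>
  An isomorphism out of a coproduct transports the joint epicity of the coprojections to its
  codomain; a dichotomy presents \<open>F(S)\<close> in this way.
\<close>

lemma coproduct_iso_jointly_epic:
  assumes C: "category C" and cop: "is_coproduct C K D Q i j"
    and c: "c \<in> Hom C Q A" "is_iso C c"
    and \<phi>: "\<phi> \<in> Hom C A X" and \<psi>: "\<psi> \<in> Hom C A X"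
    and eqi: "\<phi> \<cdot>\<^bsub>C\<^esub> (c \<cdot>\<^bsub>C\<^esub> i) = \<psi> \<cdot>\<^bsub>C\<^esub> (c \<cdot>\<^bsub>C\<^esub> i)"
    and eqj: "\<phi> \<cdot>\<^bsub>C\<^esub> (c \<cdot>\<^bsub>C\<^esub> j) = \<psi> \<cdot>\<^bsub>C\<^esub> (c \<cdot>\<^bsub>C\<^esub> j)"
  shows "\<phi> = \<psi>"
proof -
  interpret category C by fact
  have i: "i \<in> Hom C K Q" and j: "j \<in> Hom C D Q" using cop by (auto simp: is_coproduct_def)
  have \<phi>c: "\<phi> \<cdot>\<^bsub>C\<^esub> c \<in> Hom C Q X" and \<psi>c: "\<psi> \<cdot>\<^bsub>C\<^esub> c \<in> Hom C Q X"
    using Comp_Hom[OF c(1)] \<phi> \<psi> by auto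
  have "(\<phi> \<cdot>\<^bsub>C\<^esub> c) \<cdot>\<^bsub>C\<^esub> i = (\<psi> \<cdot>\<^bsub>C\<^esub> c) \<cdot>\<^bsub>C\<^esub> i" "(\<phi> \<cdot>\<^bsub>C\<^esub> c) \<cdot>\<^bsub>C\<^esub> j = (\<psi> \<cdot>\<^bsub>C\<^esub> c) \<cdot>\<^bsub>C\<^esub> j"
    using eqi eqj Comp_assoc[OF i c(1)] Comp_assoc[OF j c(1)] \<phi> \<psi> by auto
  moreover have "\<exists>!h. h \<in> Hom C Q X \<and> h \<cdot>\<^bsub>C\<^esub> i = (\<psi> \<cdot>\<^bsub>C\<^esub> c) \<cdot>\<^bsub>C\<^esub> i \<and> h \<cdot>\<^bsub>C\<^esub> j = (\<psi> \<cdot>\<^bsub>C\<^esub> c) \<cdot>\<^bsub>C\<^esub> j"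
    using cop Comp_Hom[OF i \<psi>c] Comp_Hom[OF j \<psi>c] by (auto simp: is_coproduct_def)
  ultimately have eq: "\<phi> \<cdot>\<^bsub>C\<^esub> c = \<psi> \<cdot>\<^bsub>C\<^esub> c" using \<phi>c \<psi>c by blast
  obtain d where d: "d \<in> Hom C A Q" "c \<cdot>\<^bsub>C\<^esub> d = Id C A"
    using c by (auto simp: is_iso_def Hom_def)
  have "\<phi> \<cdot>\<^bsub>C\<^esub> Id C A = \<psi> \<cdot>\<^bsub>C\<^esub> Id C A"
    using eq Comp_assoc[OF d(1) c(1) \<phi>] Comp_assoc[OF d(1) c(1) \<psi>] d(2) by simp
  then show ?thesis using Id_right \<phi> \<psi> by simp
qed

text \<open>
  Whether one subobject contains another can be checked on any jointly epic family, here a pair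
  \<open>\<kappa>\<close>, \<open>\<delta>\<close>: their characteristic maps agree after restriction to \<open>\<kappa>\<close> and to \<open>\<delta>\<close>, hence
  agree. The assumption \<open>n \<le> m\<close> turns the inclusion to be proved into an equality.
\<close>

lemma sub_le_on_cover:
  assumes top: "topos C" and nm: "sub_le C A n m"
    and \<kappa>: "\<kappa> \<in> Hom C K A" and \<delta>: "\<delta> \<in> Hom C D A"
    and epic: "\<And>X \<phi> \<psi>. \<lbrakk>\<phi> \<in> Hom C A X; \<psi> \<in> Hom C A X; \<phi> \<cdot>\<^bsub>C\<^esub> \<kappa> = \<psi> \<cdot>\<^bsub>C\<^esub> \<kappa>; \<phi> \<cdot>\<^bsub>C\<^esub> \<delta> = \<psi> \<cdot>\<^bsub>C\<^esub> \<delta>\<rbrakk>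
      \<Longrightarrow> \<phi> = \<psi>"
    and on_\<kappa>: "\<And>Y f. \<lbrakk>f \<in> Hom C Y K; factors_through C (\<kappa> \<cdot>\<^bsub>C\<^esub> f) m\<rbrakk> \<Longrightarrow> factors_through C (\<kappa> \<cdot>\<^bsub>C\<^esub> f) n"
    and on_\<delta>: "\<And>Y f. \<lbrakk>f \<in> Hom C Y D; factors_through C (\<delta> \<cdot>\<^bsub>C\<^esub> f) m\<rbrakk> \<Longrightarrow> factors_through C (\<delta> \<cdot>\<^bsub>C\<^esub> f) n"
  shows "sub_le C A m n"
proof -
  have C: "category C" using top by (simp add: topos_def)
  interpret category C by fact
  obtain t where t: "is_subobject_classifier C t" using top by (auto simp: topos_def)
  have tA: "t \<in> Arr C" using t by (auto simp: is_subobject_classifier_def)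
  have m: "is_mono C m" "Cod C m = A" and n: "is_mono C n" "Cod C n = A"
    and ft: "factors_through C n m"
    using nm by (auto simp: sub_le_def represents_sub_def)
  have mA: "m \<in> Arr C" using m by (simp add: is_mono_def)
  have mH: "m \<in> Hom C (Dom C m) A" using Arr_Hom[OF mA] m by simp
  obtain \<chi> u where \<chi>: "\<chi> \<in> Hom C A (Cod C t)" and pm: "is_pullback C \<chi> t m u"
    using t m unfolding is_subobject_classifier_def by metis
  obtain \<theta> v where \<theta>: "\<theta> \<in> Hom C A (Cod C t)" and pn: "is_pullback C \<theta> t n v"
    using t n unfolding is_subobject_classifier_def by metis
  have in_m: "sends_to_true C t \<chi> f \<longleftrightarrow> factors_through C f m" if "f \<in> Hom C Y A" for Y f
    using pullback_sends_to_true_iff[OF C tA _ pm] \<chi> m that by simp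
  have in_n: "sends_to_true C t \<theta> f \<longleftrightarrow> factors_through C f n" if "f \<in> Hom C Y A" for Y f
    using pullback_sends_to_true_iff[OF C tA _ pn] \<theta> n that by simp
  have agree: "\<chi> \<cdot>\<^bsub>C\<^esub> k = \<theta> \<cdot>\<^bsub>C\<^esub> k"
    if k: "k \<in> Hom C B A"
      and on_k: "\<And>Y f. \<lbrakk>f \<in> Hom C Y B; factors_through C (k \<cdot>\<^bsub>C\<^esub> f) m\<rbrakk> \<Longrightarrow> factors_through C (k \<cdot>\<^bsub>C\<^esub> f) n"
    for B k
  proof (rule truth_maps_eqI[OF top t Comp_Hom[OF k \<chi>] Comp_Hom[OF k \<theta>]])
    fix Y f assume f: "f \<in> Hom C Y B"
    have "factors_through C (k \<cdot>\<^bsub>C\<^esub> f) m \<longleftrightarrow> factors_through C (k \<cdot>\<^bsub>C\<^esub> f) n"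
      using on_k[OF f] factors_through_trans[OF C _ ft mA] by blast
    then show "sends_to_true C t (\<chi> \<cdot>\<^bsub>C\<^esub> k) f \<longleftrightarrow> sends_to_true C t (\<theta> \<cdot>\<^bsub>C\<^esub> k) f"
      using sends_to_true_comp[OF C f k \<chi>] sends_to_true_comp[OF C f k \<theta>]
        in_m[OF Comp_Hom[OF f k]] in_n[OF Comp_Hom[OF f k]] by simp
  qed
  have same: "\<chi> = \<theta>"
  proof (rule epic[OF \<chi> \<theta>])
    show "\<chi> \<cdot>\<^bsub>C\<^esub> \<kappa> = \<theta> \<cdot>\<^bsub>C\<^esub> \<kappa>" by (rule agree[OF \<kappa>]) (rule on_\<kappa>)
    show "\<chi> \<cdot>\<^bsub>C\<^esub> \<delta> = \<theta> \<cdot>\<^bsub>C\<^esub> \<delta>" by (rule agree[OF \<delta>]) (rule on_\<delta>)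
  qed
  have "m \<cdot>\<^bsub>C\<^esub> Id C (Dom C m) = m" using Id_right[OF mH] .
  then have "factors_through C m m"
    using Id_Hom[OF Dom_Obj[OF mA]] by (auto simp: factors_through_def)
  then have "factors_through C m n" using in_m[OF mH] in_n[OF mH] same by simp
  then show ?thesis using nm by (simp add: sub_le_def)
qed

section \<open>Subobjects of a coproduct\<close>

text \<open>
  Elements of \<open>m\<close> over \<open>\<kappa>\<close> lie in \<open>m \<and> \<kappa>\<close>, which is below everything, and elements of \<open>m\<close> over
  \<open>\<delta>\<close> lie in \<open>m \<and> \<delta>\<close>; so \<open>m \<le> m \<and> \<delta>\<close> by the test on the cover.
\<close>

lemma disjoint_from_summand_le_other:
  assumes top: "topos C" and \<kappa>: "represents_sub C A \<kappa>" and \<delta>: "represents_sub C A \<delta>"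
    and cop: "is_coproduct C (Dom C \<kappa>) (Dom C \<delta>) Q i j"
    and c: "c \<in> Hom C Q A" "is_iso C c" "c \<cdot>\<^bsub>C\<^esub> i = \<kappa>" "c \<cdot>\<^bsub>C\<^esub> j = \<delta>"
    and w: "is_meet C A m \<kappa> w" and zero: "is_zero_sub C A w"
  shows "sub_le C A m \<delta>"
proof -
  have C: "category C" using top by (simp add: topos_def)
  interpret category C by fact
  have "sub_le C A w m" using w by (simp add: is_meet_def)
  then have m: "represents_sub C A m" by (simp add: sub_le_def)
  have \<kappa>H: "\<kappa> \<in> Hom C (Dom C \<kappa>) A" and \<delta>H: "\<delta> \<in> Hom C (Dom C \<delta>) A"
    using \<kappa> \<delta> by (auto simp: represents_sub_def is_mono_def Hom_def)
  obtain n where n: "sub_le C A n m" "sub_le C A n \<delta>"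
    and n_elem: "\<And>Y f. \<lbrakk>f \<in> Hom C Y A; factors_through C f m; factors_through C f \<delta>\<rbrakk>
      \<Longrightarrow> factors_through C f n"
    using elementwise_meet_exists[OF top m \<delta>] by blast
  obtain z where z: "sub_le C A z m" "sub_le C A z \<kappa>"
    and z_elem: "\<And>Y f. \<lbrakk>f \<in> Hom C Y A; factors_through C f m; factors_through C f \<kappa>\<rbrakk>
      \<Longrightarrow> factors_through C f z"
    using elementwise_meet_exists[OF top m \<kappa>] by blast
  have nA: "n \<in> Arr C" and \<delta>A: "\<delta> \<in> Arr C"
    using n(1) \<delta> by (auto simp: sub_le_def represents_sub_def is_mono_def)
  have "sub_le C A z w" using w z unfolding is_meet_def by blast
  moreover have "sub_le C A w n"
    using zero n(1) unfolding is_zero_sub_def sub_le_def by blast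
  ultimately have "factors_through C z w" "factors_through C w n" by (simp_all add: sub_le_def)
  then have zn: "factors_through C z n" using factors_through_trans[OF C _ _ nA] by blast
  have "sub_le C A m n"
  proof (rule sub_le_on_cover[OF top n(1) \<kappa>H \<delta>H])
    show "\<phi> = \<psi>"
      if "\<phi> \<in> Hom C A X" "\<psi> \<in> Hom C A X" "\<phi> \<cdot>\<^bsub>C\<^esub> \<kappa> = \<psi> \<cdot>\<^bsub>C\<^esub> \<kappa>" "\<phi> \<cdot>\<^bsub>C\<^esub> \<delta> = \<psi> \<cdot>\<^bsub>C\<^esub> \<delta>" for X \<phi> \<psi>
      using coproduct_iso_jointly_epic[OF C cop c(1,2) that(1,2)] that(3,4) c(3,4) by simp
    show "factors_through C (\<kappa> \<cdot>\<^bsub>C\<^esub> f) n"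
      if f: "f \<in> Hom C Y (Dom C \<kappa>)" and fm: "factors_through C (\<kappa> \<cdot>\<^bsub>C\<^esub> f) m" for Y f
    proof -
      have "factors_through C (\<kappa> \<cdot>\<^bsub>C\<^esub> f) \<kappa>"
        using f HomD[OF Comp_Hom[OF f \<kappa>H]] by (auto intro: factors_through_compI)
      then show ?thesis
        using z_elem[OF Comp_Hom[OF f \<kappa>H] fm] factors_through_trans[OF C _ zn nA] by blast
    qed
    show "factors_through C (\<delta> \<cdot>\<^bsub>C\<^esub> f) n"
      if f: "f \<in> Hom C Y (Dom C \<delta>)" and fm: "factors_through C (\<delta> \<cdot>\<^bsub>C\<^esub> f) m" for Y f
    proof -
      have "factors_through C (\<delta> \<cdot>\<^bsub>C\<^esub> f) \<delta>"
        using f HomD[OF Comp_Hom[OF f \<delta>H]] by (auto intro: factors_through_compI)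
      then show ?thesis using n_elem[OF Comp_Hom[OF f \<delta>H] fm] by blast
    qed
  qed
  then show ?thesis
    using n(2) factors_through_trans[OF C _ _ \<delta>A] by (auto simp: sub_le_def)
qed

theorem proposition5p7:
  fixes M :: "('o1, 'a1) category" and E :: "('o2, 'a2) category"
    and F :: "('o1, 'a1, 'o2, 'a2) functor_data"
    and S :: 'o1 and p g :: 'a1 and \<kappa> \<delta> \<xi> :: 'a2
  assumes "category M" and "topos E" and "is_functor M E F" and "S \<in> Obj M"
    and "quasipolarity M E F S p" and "dichotomy M E F S p \<kappa> \<delta>"
    and "consonance E \<kappa> \<xi>"
    and "counterpoint_symmetry M E F S p \<kappa> \<delta> \<xi> g"
    and "\<not> sub_le E (ob F S) (ar F g \<cdot>\<^bsub>E\<^esub> \<kappa>) \<delta>"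
  shows "\<forall>w. is_meet E (ob F S) (ar F g \<cdot>\<^bsub>E\<^esub> \<kappa>) \<kappa> w \<longrightarrow> \<not> is_zero_sub E (ob F S) w"
proof (intro allI impI notI)
  fix w
  assume w: "is_meet E (ob F S) (ar F g \<cdot>\<^bsub>E\<^esub> \<kappa>) \<kappa> w" and zero: "is_zero_sub E (ob F S) w"
  obtain Q i j c where reps: "represents_sub E (ob F S) \<kappa>" "represents_sub E (ob F S) \<delta>"
    and cop: "is_coproduct E (Dom E \<kappa>) (Dom E \<delta>) Q i j"
    and c: "c \<in> Hom E Q (ob F S)" "is_iso E c" "c \<cdot>\<^bsub>E\<^esub> i = \<kappa>" "c \<cdot>\<^bsub>E\<^esub> j = \<delta>"
    using assms(6) unfolding dichotomy_def by blast
  have "sub_le E (ob F S) (ar F g \<cdot>\<^bsub>E\<^esub> \<kappa>) \<delta>"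
    by (rule disjoint_from_summand_le_other[OF assms(2) reps cop c w zero])
  then show False using assms(9) by contradiction
qed

end
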